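(* Let $\mathcal{X}$ be a complex separable Hilbert space, $(\Omega,\mu)$ a measure space with positive measure $\mu$, let $\{\Xi_\omega\}_{\omega\in\Omega}$ be a continuous frame for $\mathcal{X}$ with frame operator $\mathcal{T}_\Xi$, and let $\{\Phi_\omega\}_{\omega\in\Omega}$ be a family in $\mathcal{X}$. The following are equivalent: (i) $\{\Phi_\omega\}$ is a Bessel sequence for $\mathcal{X}$ and $(\{\Xi_\omega\},\{\Phi_\omega\})$ is a continuous biframe for $\mathcal{X}$. (ii) There exist a Bessel sequence $\{\eta_\omega\}_{\omega\in\Omega}$ in $\mathcal{X}$ and an operator $\mathcal{Q}\in B^{+}_{b,b}(\mathcal{X})$ such that for every $\omega\in\Omega$, $$\Phi_\omega=(\mathcal{T}_\Xi\mathcal{Q})^{-1}\Xi_\omega+\eta_\omega-\int_\Omega\langle\mathcal{T}_\Xi^{-1}\Xi_\omega,\Xi_k\rangle\,\eta_k\,d\mu(k).$$ (iii) $\{\Phi_\omega\}$ is a continuous frame for $\mathcal{X}$ and $(\{\Xi_\omega\},\{\Phi_\omega\})$ is a continuous biframe for $\mathcal{X}$.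
   Context: Inner products are linear in the first variable; vector-valued integrals are understood in the weak sense. A family $\{\Xi_\omega\}_{\omega\in\Omega}$ in $\mathcal{X}$ is weakly measurable if $\omega\mapsto\langle\xi,\Xi_\omega\rangle$ is measurable for each $\xi$. It is a continuous frame if it is weakly measurable and there are $C,D>0$ with $C\|\xi\|^2\le\int_\Omega|\langle\xi,\Xi_\omega\rangle|^2\,d\mu(\omega)\le D\|\xi\|^2$ for all $\xi\in\mathcal{X}$, and a Bessel sequence if it is weakly measurable and the upper inequality holds for some $D>0$. The frame operator is $\mathcal{T}_\Xi\xi=\int_\Omega\langle\xi,\Xi_\omega\rangle\Xi_\omega\,d\mu(\omega)$, a positive invertible bounded operator. A pair $(\Xi,\Phi)$ of weakly measurable families is a continuous biframe for $\mathcal{X}$ if there are $C,D>0$ with $C\|\xi\|^2\le\int_\Omega\langle\xi,\Xi_\omega\rangle\langle\Phi_\omega,\xi\rangle\,d\mu(\omega)\le D\|\xi\|^2$ for all $\xi\in\mathcal{X}$. $B^{+}_{b,b}(\mathcal{X})$ is the set of positive bounded operators on $\mathcal{X}$ that are bounded below (equivalently, positive invertible bounded operators). *)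

theory Defs
  imports "HOL-Analysis.Analysis"
begin

class complex_vector = real_vector +
  fixes scaleC :: "complex \<Rightarrow> 'a \<Rightarrow> 'a" (infixr "*\<^sub>C" 75)
  assumes scaleC_add_right: "a *\<^sub>C (x + y) = a *\<^sub>C x + a *\<^sub>C y"
    and scaleC_add_left: "(a + b) *\<^sub>C x = a *\<^sub>C x + b *\<^sub>C x"
    and scaleC_scaleC: "a *\<^sub>C (b *\<^sub>C x) = (a * b) *\<^sub>C x"
    and scaleR_scaleC: "r *\<^sub>R x = complex_of_real r *\<^sub>C x"

(* The inner product is linear in its first argument and conjugate-linear in the second. *)
class complex_inner = complex_vector + real_normed_vector +
  fixes cinner :: "'a \<Rightarrow> 'a \<Rightarrow> complex"
  assumes cinner_commute: "cinner x y = cnj (cinner y x)"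
    and cinner_add_left: "cinner (x + y) z = cinner x z + cinner y z"
    and cinner_scaleC_left: "cinner (a *\<^sub>C x) y = a * cinner x y"
    and cinner_ge_zero: "0 \<le> Re (cinner x x)"
    and cinner_eq_zero_iff: "cinner x x = 0 \<longleftrightarrow> x = 0"
    and norm_eq_sqrt_cinner: "norm x = sqrt (Re (cinner x x))"

class chilbert_space = complex_inner + complete_space

(* The set Omega is \<open>space M\<close>; families are total functions of which only the values on
   \<open>space M\<close> matter. *)
definition weakly_measurable :: "'w measure \<Rightarrow> ('w \<Rightarrow> 'a::complex_inner) \<Rightarrow> bool"
  where "weakly_measurable M \<Xi> \<longleftrightarrow> (\<forall>\<xi>. (\<lambda>\<omega>. cinner \<xi> (\<Xi> \<omega>)) \<in> borel_measurable M)"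

definition continuous_frame :: "'w measure \<Rightarrow> ('w \<Rightarrow> 'a::complex_inner) \<Rightarrow> bool"
  where "continuous_frame M \<Xi> \<longleftrightarrow> weakly_measurable M \<Xi> \<and>
    (\<exists>C>0. \<exists>D>0. \<forall>\<xi>.
        ennreal (C * (norm \<xi>)\<^sup>2) \<le> (\<integral>\<^sup>+ \<omega>. ennreal ((cmod (cinner \<xi> (\<Xi> \<omega>)))\<^sup>2) \<partial>M) \<and>
        (\<integral>\<^sup>+ \<omega>. ennreal ((cmod (cinner \<xi> (\<Xi> \<omega>)))\<^sup>2) \<partial>M) \<le> ennreal (D * (norm \<xi>)\<^sup>2))"

definition bessel_sequence :: "'w measure \<Rightarrow> ('w \<Rightarrow> 'a::complex_inner) \<Rightarrow> bool"
  where "bessel_sequence M \<Xi> \<longleftrightarrow> weakly_measurable M \<Xi> \<and>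
    (\<exists>D>0. \<forall>\<xi>.
        (\<integral>\<^sup>+ \<omega>. ennreal ((cmod (cinner \<xi> (\<Xi> \<omega>)))\<^sup>2) \<partial>M) \<le> ennreal (D * (norm \<xi>)\<^sup>2))"

(* Here the integrand is complex-valued: the inequalities mean that it is integrable and that
   its integral is a real number between the two bounds. *)
definition continuous_biframe ::
    "'w measure \<Rightarrow> ('w \<Rightarrow> 'a::complex_inner) \<Rightarrow> ('w \<Rightarrow> 'a) \<Rightarrow> bool"
  where "continuous_biframe M \<Xi> \<Phi> \<longleftrightarrow> weakly_measurable M \<Xi> \<and> weakly_measurable M \<Phi> \<and>
    (\<exists>C>0. \<exists>D>0. \<forall>\<xi>. \<exists>r::real.
        has_bochner_integral M (\<lambda>\<omega>. cinner \<xi> (\<Xi> \<omega>) * cinner (\<Phi> \<omega>) \<xi>) (complex_of_real r) \<and>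
        C * (norm \<xi>)\<^sup>2 \<le> r \<and> r \<le> D * (norm \<xi>)\<^sup>2)"

definition has_weak_integral :: "'w measure \<Rightarrow> ('w \<Rightarrow> 'a::complex_inner) \<Rightarrow> 'a \<Rightarrow> bool"
  where "has_weak_integral M f v \<longleftrightarrow>
    (\<forall>\<xi>. has_bochner_integral M (\<lambda>\<omega>. cinner (f \<omega>) \<xi>) (cinner v \<xi>))"

(* A weak integral is unique if it exists; it exists whenever \<open>f \<omega> = g \<omega> *\<^sub>C \<eta> \<omega>\<close> with g square
   integrable and \<open>\<eta>\<close> a Bessel sequence in a Hilbert space. *)
definition weak_integral :: "'w measure \<Rightarrow> ('w \<Rightarrow> 'a::complex_inner) \<Rightarrow> 'a"
  where "weak_integral M f = (THE v. has_weak_integral M f v)"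

definition frame_operator :: "'w measure \<Rightarrow> ('w \<Rightarrow> 'a::complex_inner) \<Rightarrow> 'a \<Rightarrow> 'a"
  where "frame_operator M \<Xi> \<xi> = weak_integral M (\<lambda>\<omega>. cinner \<xi> (\<Xi> \<omega>) *\<^sub>C \<Xi> \<omega>)"

definition bounded_clinear :: "('a::complex_inner \<Rightarrow> 'a) \<Rightarrow> bool"
  where "bounded_clinear Q \<longleftrightarrow> bounded_linear Q \<and> (\<forall>c x. Q (c *\<^sub>C x) = c *\<^sub>C Q x)"

definition positive_operator :: "('a::complex_inner \<Rightarrow> 'a) \<Rightarrow> bool"
  where "positive_operator Q \<longleftrightarrow> (\<forall>x. cinner (Q x) x \<in> \<real> \<and> 0 \<le> Re (cinner (Q x) x))"

definition bounded_below :: "('a::complex_inner \<Rightarrow> 'a) \<Rightarrow> bool"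
  where "bounded_below Q \<longleftrightarrow> (\<exists>m>0. \<forall>x. m * norm x \<le> norm (Q x))"

definition Bpos_bb :: "('a::complex_inner \<Rightarrow> 'a) set"
  where "Bpos_bb = {Q. bounded_clinear Q \<and> positive_operator Q \<and> bounded_below Q}"

end

(* Write S for the operator x |-> int <x, Xi_k> Phi_k dk attached to two Bessel sequences. The pair
   (Xi, Phi) is a biframe iff S is positive and bounded below. If it is, then S T^-1 Xi is the
   integral term of (ii) for eta = Phi, so (ii) holds with eta = Phi and Q = S^-1. Conversely, for Phi
   as in (ii), the eta-terms cancel in S, because inserting T^-1 Xi for Phi gives T^-1 T = id, and
   S = Q^-1 remains. The lower frame bound in (iii) is the Cauchy-Schwarz inequality. *)
theory Submission
  imports Defs
begin

subsection \<open>Complex inner product spaces\<close>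

text \<open>A weak integral is known only through its pairings with test vectors, and
  \<open>weak_integral\<close> selects it by a definite description, so its properties are out of
  reach until existence is settled. Hence the Riesz theorem, applied to the scalar integral as a
  function of the test vector; afterwards identities between operators are checked under
  \<open>cinner\<close>. For the same reason an operator leaves an integral by shifting its adjoint
  onto the test vector, which is why the lemmas on images of families take a pair \<open>A\<close>,
  \<open>B\<close> of mutually adjoint maps. The second obstacle is the inverses in (ii):
  \<open>inv\<close> is a total function and means the inverse operator only for bijections. A
  positive operator that is bounded below in norm is therefore first shown to have a quadratic form
  bounded below by a multiple of the squared norm. This coercivity yields surjectivity by a
  fixed-point argument, passes to the inverse, and has the same shape as the lower biframe
  inequality.\<close>

lemma cinner_add_right: "cinner x (y + z) = cinner x y + cinner (x::'a::complex_inner) z"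
  by (metis cinner_add_left cinner_commute complex_cnj_add)

lemma cinner_scaleC_right: "cinner x (a *\<^sub>C y) = cnj a * cinner (x::'a::complex_inner) y"
  by (metis cinner_commute cinner_scaleC_left complex_cnj_mult)

lemma cinner_scaleR_left: "cinner (r *\<^sub>R x) y = of_real r * cinner (x::'a::complex_inner) y"
  by (simp add: scaleR_scaleC cinner_scaleC_left)

lemma cinner_scaleR_right: "cinner x (r *\<^sub>R y) = of_real r * cinner (x::'a::complex_inner) y"
  by (simp add: scaleR_scaleC cinner_scaleC_right)

lemma cinner_minus_left: "cinner (- x) y = - cinner (x::'a::complex_inner) y"
  using cinner_scaleR_left[of "-1" x y] by simp

lemma cinner_minus_right: "cinner x (- y) = - cinner (x::'a::complex_inner) y"
  using cinner_scaleR_right[of x "-1" y] by simp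

lemma cinner_zero_left: "cinner 0 (y::'a::complex_inner) = 0"
  using cinner_scaleR_left[of 0 0 y] by simp

lemma cinner_diff_left: "cinner (x - y) z = cinner x z - cinner (y::'a::complex_inner) z"
  using cinner_add_left[of x "- y" z] by (simp add: cinner_minus_left)

lemma cinner_diff_right: "cinner x (y - z) = cinner x y - cinner (x::'a::complex_inner) z"
  using cinner_add_right[of x y "- z"] by (simp add: cinner_minus_right)

lemma Re_cinner_commute: "Re (cinner x y) = Re (cinner (y::'a::complex_inner) x)"
  by (subst cinner_commute) simp

lemma Re_cinner_self: "Re (cinner x x) = (norm (x::'a::complex_inner))\<^sup>2"
  by (simp add: norm_eq_sqrt_cinner cinner_ge_zero)

lemma cinner_eqI:
  assumes "\<And>z. cinner x z = cinner y z"
  shows "x = (y::'a::complex_inner)"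
proof -
  have "cinner (x - y) (x - y) = 0"
    using assms by (simp add: cinner_diff_left)
  then show ?thesis
    by (simp add: cinner_eq_zero_iff)
qed

lemma norm_add_square:
  "(norm (x + y))\<^sup>2 = (norm x)\<^sup>2 + 2 * Re (cinner x y) + (norm (y::'a::complex_inner))\<^sup>2"
  unfolding Re_cinner_self[symmetric]
  by (simp add: cinner_add_left cinner_add_right Re_cinner_commute[of y x])

lemma norm_diff_square:
  "(norm (x - y))\<^sup>2 = (norm x)\<^sup>2 - 2 * Re (cinner x y) + (norm (y::'a::complex_inner))\<^sup>2"
  using norm_add_square[of x "- y"] by (simp add: cinner_minus_right)

lemma norm_scaleC: "norm (a *\<^sub>C x) = cmod a * norm (x::'a::complex_inner)"
proof -
  have "(norm (a *\<^sub>C x))\<^sup>2 = Re (a * cnj a * cinner x x)"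
    unfolding Re_cinner_self[symmetric]
    by (simp add: cinner_scaleC_left cinner_scaleC_right mult_ac)
  also have "\<dots> = (cmod a * norm x)\<^sup>2"
    by (simp add: complex_norm_square[symmetric] Re_cinner_self power_mult_distrib
        flip: of_real_power)
  finally show ?thesis
    by (rule power2_eq_imp_eq) auto
qed

text \<open>The triangle inequality already belongs to the normed space structure, so the
  Cauchy-Schwarz inequality is read off from it: squaring bounds the real part, and a rotation of
  \<open>x\<close> makes the inner product real and nonnegative.\<close>

lemma cmod_cinner_le: "cmod (cinner x y) \<le> norm x * norm (y::'a::complex_inner)"
proof -
  have Re_le: "Re (cinner u v) \<le> norm u * norm v" for u v :: 'a
  proof -
    have "(norm (u + v))\<^sup>2 \<le> (norm u + norm v)\<^sup>2"
      by (simp add: norm_triangle_ineq power_mono)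
    then show ?thesis
      by (simp add: norm_add_square power2_sum)
  qed
  \<comment> \<open>The conjugate phase of the inner product. For orthogonal vectors
    \<open>sgn\<close> gives 0, so only \<open>cmod a \<le> 1\<close> holds in general, which is
    enough.\<close>
  define a where "a = cnj (sgn (cinner x y))"
  have "a * cinner x y = of_real (cmod (cinner x y))"
    by (simp add: a_def sgn_eq complex_norm_square[symmetric] power2_eq_square mult.commute)
  then have "cmod (cinner x y) = Re (cinner (a *\<^sub>C x) y)"
    by (simp add: cinner_scaleC_left)
  also have "\<dots> \<le> norm (a *\<^sub>C x) * norm y"
    by (rule Re_le)
  also have "\<dots> \<le> norm x * norm y"
    by (simp add: norm_scaleC a_def norm_sgn mult_right_mono)
  finally show ?thesis .
qed

lemma Re_cinner_le: "Re (cinner x y) \<le> norm x * norm (y::'a::complex_inner)"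
  using complex_Re_le_cmod cmod_cinner_le order_trans by blast

text \<open>The representing vector minimises \<open>\<lambda>x. \<parallel>x\<parallel>\<^sup>2 - 2 g x\<close>; by the
  parallelogram law every minimising sequence is Cauchy.\<close>

lemma riesz_real:
  fixes g :: "'a::chilbert_space \<Rightarrow> real"
  assumes "bounded_linear g"
  obtains v where "\<And>x. Re (cinner v x) = g x"
proof -
  interpret bounded_linear g by fact
  define J where "J x = (norm x)\<^sup>2 - 2 * g x" for x
  obtain K where K: "\<And>x. norm (g x) \<le> norm x * K"
    using bounded by blast
  \<comment> \<open>With s the norm of \<open>x\<close>, \<open>J x\<close> is at least s*s - 2*K*s;
    complete the square.\<close>
  have "- (K\<^sup>2) \<le> J x" for x
  proof -
    have "0 \<le> (norm x - K)\<^sup>2"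
      by simp
    moreover have "g x \<le> norm x * K"
      using K[of x] by simp
    ultimately show ?thesis
      by (simp add: J_def power2_diff)
  qed
  then have bdd: "bdd_below (range J)"
    by (meson bdd_belowI2)
  define d where "d = Inf (range J)"
  have d_le: "d \<le> J x" for x
    unfolding d_def using bdd by (simp add: cInf_lower)
  have "\<exists>x. J x < d + 1 / real (Suc n)" for n
    using cInf_lessD[of "range J" "d + 1 / real (Suc n)"] by (auto simp: d_def)
  then obtain X where X: "\<And>n. J (X n) < d + 1 / real (Suc n)"
    by metis
  \<comment> \<open>The term with \<open>d\<close> comes from the midpoint of \<open>x\<close> and
    \<open>y\<close>, where \<open>J\<close> is still at least \<open>d\<close>.\<close>
  have dist: "(norm (x - y))\<^sup>2 \<le> 2 * J x + 2 * J y - 4 * d" for x y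
  proof -
    have "J ((1/2) *\<^sub>R (x + y)) = (norm (x + y))\<^sup>2 / 4 - g x - g y"
      by (simp only: J_def scaleR add norm_scaleR) (simp add: power_divide add_divide_distrib)
    then have "4 * d \<le> (norm (x + y))\<^sup>2 - 4 * g x - 4 * g y"
      using d_le[of "(1/2) *\<^sub>R (x + y)"] by linarith
    then show ?thesis
      unfolding J_def norm_add_square norm_diff_square right_diff_distrib by linarith
  qed
  have "Cauchy X"
  proof (rule metric_CauchyI)
    fix e :: real
    assume "0 < e"
    then have "0 < e\<^sup>2 / 4"
      by simp
    then obtain N where N: "1 / real (Suc N) < e\<^sup>2 / 4"
      using nat_approx_posE by metis
    have "dist (X m) (X n) < e" if "m \<ge> N" "n \<ge> N" for m n
    proof -
      have "1 / real (Suc m) \<le> 1 / real (Suc N)" "1 / real (Suc n) \<le> 1 / real (Suc N)"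
        using that by (auto intro!: divide_left_mono)
      then have "(norm (X m - X n))\<^sup>2 < e\<^sup>2"
        using dist[of "X m" "X n"] X[of m] X[of n] N by linarith
      then show ?thesis
        using \<open>0 < e\<close> by (simp add: dist_norm power_less_imp_less_base)
    qed
    then show "\<exists>N. \<forall>m\<ge>N. \<forall>n\<ge>N. dist (X m) (X n) < e"
      by blast
  qed
  then obtain v where v: "X \<longlonglongrightarrow> v"
    using Cauchy_convergent convergent_def by blast
  have "(\<lambda>n. J (X n)) \<longlonglongrightarrow> J v"
    unfolding J_def by (intro tendsto_intros v tendsto)
  moreover have "(\<lambda>n. d + 1 / real (Suc n)) \<longlonglongrightarrow> d + 0"
    by (rule tendsto_add[OF tendsto_const LIMSEQ_Suc[OF lim_const_over_n[of 1]]])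
  ultimately have "J v \<le> d + 0"
    by (rule LIMSEQ_le) (use X less_imp_le in blast)
  then have J_v: "J v \<le> d"
    by simp
  have "Re (cinner v x) = g x" for x
  proof -
    define a b where "a = Re (cinner v x) - g x" and "b = (norm x)\<^sup>2"
    \<comment> \<open>Near-optimal step from \<open>v\<close> in direction \<open>x\<close>. The
      denominator \<open>b + 1\<close> instead of \<open>b\<close> avoids a case split at
      \<open>x = 0\<close> and still makes the increment of \<open>J\<close> negative unless
      \<open>a = 0\<close>.\<close>
    define t where "t = - a / (b + 1)"
    have b: "0 \<le> b"
      by (simp add: b_def)
    have "J (v + t *\<^sub>R x) = J v + 2 * t * a + t\<^sup>2 * b"
      unfolding J_def norm_add_square
      by (simp add: a_def b_def add scaleR cinner_scaleR_right algebra_simps)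
    then have "0 \<le> 2 * t * a + t\<^sup>2 * b"
      using J_v d_le[of "v + t *\<^sub>R x"] by linarith
    also have "2 * t * a + t\<^sup>2 * b = - (a\<^sup>2 * (b + 2)) / (b + 1)\<^sup>2"
      using b by (simp add: t_def divide_simps) (simp add: power2_eq_square algebra_simps)
    finally have "a\<^sup>2 * (b + 2) \<le> 0"
      using b by (simp add: divide_simps split: if_splits)
    then have "a = 0"
      using b by (simp add: mult_le_0_iff)
    then show ?thesis
      by (simp add: a_def)
  qed
  then show ?thesis
    using that by blast
qed

text \<open>The real part of an antilinear functional determines it: evaluating the real part at
  \<open>\<i> *\<^sub>C x\<close> returns the imaginary part at \<open>x\<close>. Antilinearity is
  the right hypothesis because test vectors sit in the second, conjugate-linear slot of
  \<open>cinner\<close>.\<close>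

lemma riesz_antilinear:
  fixes F :: "'a::chilbert_space \<Rightarrow> complex"
  assumes add: "\<And>x y. F (x + y) = F x + F y"
    and scale: "\<And>a x. F (a *\<^sub>C x) = cnj a * F x"
    and bound: "\<And>x. cmod (F x) \<le> K * norm x"
  obtains v where "\<And>x. cinner v x = F x"
proof -
  have "bounded_linear (\<lambda>x. Re (F x))"
  proof (rule bounded_linear_intro[where K = K])
    show "norm (Re (F x)) \<le> norm x * K" for x
      using abs_Re_le_cmod[of "F x"] bound[of x] by (simp add: mult.commute)
  qed (simp_all add: add scale scaleR_scaleC)
  then obtain v where v: "\<And>x. Re (cinner v x) = Re (F x)"
    using riesz_real by blast
  have "cinner v x = F x" for x
  proof (rule complex_eqI)
    show "Im (cinner v x) = Im (F x)"
      using v[of "\<i> *\<^sub>C x"] by (simp add: cinner_scaleC_right scale)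
  qed (rule v)
  then show ?thesis
    using that by blast
qed

subsection \<open>Positive operators bounded below\<close>

lemma bounded_clinearI:
  assumes "\<And>x y. A (x + y) = A x + A y"
    and "\<And>c x. A (c *\<^sub>C x) = c *\<^sub>C A x"
    and "\<And>x. norm (A x) \<le> K * norm x"
  shows "bounded_clinear A"
  unfolding bounded_clinear_def
  by (auto intro!: bounded_linear_intro[where K = K] simp: assms scaleR_scaleC mult.commute)

lemma bounded_clinear_bound:
  assumes "bounded_clinear A"
  obtains K where "0 < K" "\<And>x. norm (A x) \<le> K * norm x"
  using assms bounded_linear.pos_bounded unfolding bounded_clinear_def
  by (metis mult.commute)

text \<open>The Lax-Milgram argument: solutions of \<open>A x = y\<close> are the fixed points of
  \<open>x - t *\<^sub>R (A x - y)\<close>, which is a contraction for a suitable \<open>t\<close>.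
  Coercivity also makes the kernel trivial.\<close>

lemma coercive_bij:
  fixes A :: "'a::chilbert_space \<Rightarrow> 'a"
  assumes "bounded_clinear A" and "0 < c"
    and coercive: "\<And>x. c * (norm x)\<^sup>2 \<le> Re (cinner (A x) x)"
  shows "bij A"
proof (rule bijI)
  interpret bounded_linear A
    using assms(1) by (simp add: bounded_clinear_def)
  show "inj A"
  proof (rule injI)
    fix x y
    assume "A x = A y"
    then have "c * (norm (x - y))\<^sup>2 \<le> 0"
      using coercive[of "x - y"] by (simp add: diff cinner_zero_left)
    then show "x = y"
      using \<open>0 < c\<close> by (simp add: mult_le_0_iff)
  qed
  obtain K0 where K0: "\<And>x. norm (A x) \<le> K0 * norm x"
    using bounded_clinear_bound[OF assms(1)] by blast
  \<comment> \<open>On a nonzero space \<open>c \<le> K0\<close> follows from Cauchy-Schwarz; the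
    maximum also covers the zero space, so that \<open>K\<close> is positive and the root defining
    \<open>q\<close> is taken of a nonnegative number.\<close>
  define K where "K = max K0 c"
  have K: "norm (A x) \<le> K * norm x" for x
    using K0[of x] by (rule order_trans) (simp add: K_def mult_right_mono)
  have "c \<le> K" "0 < K"
    using \<open>0 < c\<close> by (auto simp: K_def)
  \<comment> \<open>This \<open>t\<close> minimises
    \<open>1 - 2 * t * c + t\<^sup>2 * K\<^sup>2\<close>, the factor that coercivity and the norm
    bound give for the squared norm; the minimum is \<open>q\<^sup>2\<close>.\<close>
  define t where "t = c / K\<^sup>2"
  define q where "q = sqrt (1 - c\<^sup>2 / K\<^sup>2)"
  have "c\<^sup>2 / K\<^sup>2 \<le> 1"
    using \<open>c \<le> K\<close> \<open>0 < K\<close> \<open>0 < c\<close> by (simp add: power_mono)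
  then have q: "0 \<le> q" "q < 1" "q\<^sup>2 = 1 - c\<^sup>2 / K\<^sup>2"
    using \<open>0 < c\<close> \<open>0 < K\<close> by (auto simp: q_def)
  have contraction: "norm (u - t *\<^sub>R A u) \<le> q * norm u" for u
  proof -
    have "(norm (u - t *\<^sub>R A u))\<^sup>2 = (norm u)\<^sup>2 - 2 * t * Re (cinner (A u) u) + t\<^sup>2 * (norm (A u))\<^sup>2"
      by (simp add: norm_diff_square cinner_scaleR_right power_mult_distrib
          Re_cinner_commute[of u])
    also have "\<dots> \<le> (norm u)\<^sup>2 - 2 * t * (c * (norm u)\<^sup>2) + t\<^sup>2 * (K * norm u)\<^sup>2"
      using \<open>0 < c\<close> \<open>0 < K\<close>
      by (intro add_mono diff_mono mult_left_mono power_mono coercive K) (auto simp: t_def)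
    also have "\<dots> = (q * norm u)\<^sup>2"
      using \<open>0 < K\<close> unfolding power_mult_distrib q(3) t_def
      by (simp add: field_simps power2_eq_square)
    finally show ?thesis
      by (rule power2_le_imp_le) (simp add: q(1))
  qed
  show "surj A"
    unfolding surj_def
  proof
    fix y
    define f where "f x = x - t *\<^sub>R (A x - y)" for x
    have "dist (f x) (f x') \<le> q * dist x x'" for x x'
      using contraction[of "x - x'"] by (simp add: dist_norm f_def diff algebra_simps)
    then obtain x where "f x = x"
      using banach_fix_type[OF q(1,2)] by blast
    then show "\<exists>x. y = A x"
      using \<open>0 < c\<close> \<open>0 < K\<close> by (auto simp: f_def t_def)
  qed
qed

text \<open>Polarization: the form is real on the diagonal, so expanding it at \<open>u + v\<close>
  relates the imaginary parts of the two cross terms. Replacing \<open>x\<close> by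
  \<open>\<i> *\<^sub>C x\<close> gives the same for the real parts.\<close>

lemma positive_operator_selfadjoint:
  assumes "bounded_clinear A" and "positive_operator A"
  shows "cinner (A x) y = cinner x (A y)"
proof -
  interpret bounded_linear A
    using assms(1) by (simp add: bounded_clinear_def)
  have scale: "A (c *\<^sub>C x) = c *\<^sub>C A x" for c x
    using assms(1) by (simp add: bounded_clinear_def)
  have real: "Im (cinner (A z) z) = 0" for z
    using assms(2) by (simp add: positive_operator_def complex_is_Real_iff)
  have Im: "Im (cinner (A u) v) = - Im (cinner (A v) u)" for u v
    using real[of "u + v"] real[of u] real[of v]
    by (simp add: add cinner_add_left cinner_add_right)
  have "Re (cinner (A x) y) = Re (cinner (A y) x)"
    using Im[of "\<i> *\<^sub>C x" y] by (simp add: scale cinner_scaleC_left cinner_scaleC_right)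
  then have "cinner (A x) y = cnj (cinner (A y) x)"
    using Im[of x y] by (simp add: complex_eq_iff)
  then show ?thesis
    by (metis cinner_commute)
qed

text \<open>Coercivity of the form is the criterion by which membership is checked throughout;
  Cauchy-Schwarz turns it into the lower norm bound.\<close>

lemma Bpos_bb_I:
  assumes "bounded_clinear A" and "0 < c"
    and form: "\<And>x. cinner (A x) x \<in> \<real>" "\<And>x. c * (norm x)\<^sup>2 \<le> Re (cinner (A x) x)"
  shows "A \<in> Bpos_bb"
proof -
  have "0 \<le> Re (cinner (A x) x)" for x
    using form(2)[of x] \<open>0 < c\<close> by (meson dual_order.trans less_imp_le mult_nonneg_nonneg zero_le_power2)
  moreover have "c * norm x \<le> norm (A x)" for x
  proof (cases "x = 0")
    case False
    have "c * norm x * norm x \<le> norm (A x) * norm x"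
      using form(2)[of x] Re_cinner_le[of "A x" x] by (simp add: power2_eq_square mult.assoc)
    then show ?thesis
      using False by simp
  qed simp
  ultimately show ?thesis
    using assms by (auto simp: Bpos_bb_def positive_operator_def bounded_below_def)
qed

text \<open>Evaluating the form \<open>\<langle>A\<cdot>, \<cdot>\<rangle>\<close> at \<open>x - A x / K\<close>, where \<open>K\<close> bounds the norm of \<open>A\<close>, gives
  \<open>\<parallel>A x\<parallel>\<^sup>2 \<le> K \<langle>A x, x\<rangle>\<close>.\<close>

lemma Bpos_bb_coercive:
  assumes "A \<in> Bpos_bb"
  obtains c where "0 < c" "\<And>x. c * (norm x)\<^sup>2 \<le> Re (cinner (A x) x)"
proof -
  have A: "bounded_clinear A" "positive_operator A"
    using assms by (auto simp: Bpos_bb_def)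
  interpret bounded_linear A
    using A(1) by (simp add: bounded_clinear_def)
  obtain m where m: "0 < m" "\<And>x. m * norm x \<le> norm (A x)"
    using assms by (auto simp: Bpos_bb_def bounded_below_def)
  obtain K where K: "0 < K" "\<And>x. norm (A x) \<le> K * norm x"
    using bounded_clinear_bound[OF A(1)] by blast
  \<comment> \<open>The constant combines the lower bound \<open>m\<close> for the norm of
    \<open>A x\<close> with the estimate of its square by \<open>K\<close> times the form.\<close>
  have "(m\<^sup>2 / K) * (norm x)\<^sup>2 \<le> Re (cinner (A x) x)" for x
  proof -
    define s where "s = 1 / K"
    define y where "y = A x"
    have "0 \<le> Re (cinner (A (x - s *\<^sub>R y)) (x - s *\<^sub>R y))"
      using A(2) by (simp add: positive_operator_def)
    also have "\<dots> = Re (cinner y x) - 2 * s * (norm y)\<^sup>2 + s\<^sup>2 * Re (cinner (A y) y)"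
      by (simp add: diff scaleR cinner_diff_left cinner_diff_right cinner_scaleR_left
          cinner_scaleR_right positive_operator_selfadjoint[OF A, of y x] y_def[symmetric]
          Re_cinner_self algebra_simps power2_eq_square)
    also have "\<dots> \<le> Re (cinner y x) - 2 * s * (norm y)\<^sup>2 + s\<^sup>2 * (K * norm y * norm y)"
      by (intro add_left_mono mult_left_mono order_trans[OF Re_cinner_le] mult_right_mono K(2)) auto
    also have "\<dots> = Re (cinner y x) - (norm y)\<^sup>2 / K"
      using K(1) by (simp add: s_def field_simps power2_eq_square)
    finally have "(norm y)\<^sup>2 / K \<le> Re (cinner y x)"
      by simp
    moreover have "(m * norm x)\<^sup>2 / K \<le> (norm y)\<^sup>2 / K"
      using m(1) m(2)[of x] K(1) by (intro divide_right_mono power_mono) (auto simp: y_def)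
    ultimately show ?thesis
      by (simp add: y_def power_mult_distrib)
  qed
  moreover have "0 < m\<^sup>2 / K"
    using m K by simp
  ultimately show ?thesis
    using that by blast
qed

lemma Bpos_bb_selfadjoint: "A \<in> Bpos_bb \<Longrightarrow> cinner (A x) y = cinner x (A y)"
  by (simp add: Bpos_bb_def positive_operator_selfadjoint)

lemma Bpos_bb_bij: "(A :: 'a::chilbert_space \<Rightarrow> 'a) \<in> Bpos_bb \<Longrightarrow> bij A"
  by (metis (no_types, lifting) Bpos_bb_coercive Bpos_bb_def coercive_bij mem_Collect_eq)

text \<open>With \<open>u = inv A x\<close>, the form of the inverse at \<open>x\<close> equals the
  form of \<open>A\<close> at \<open>u\<close>, so realness and coercivity carry over. The constant
  \<open>c / K\<^sup>2\<close> arises since the norm of \<open>x\<close> is at most \<open>K\<close>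
  times that of \<open>u\<close>.\<close>

lemma Bpos_bb_inv:
  fixes A :: "'a::chilbert_space \<Rightarrow> 'a"
  assumes "A \<in> Bpos_bb"
  shows "inv A \<in> Bpos_bb"
proof -
  have A: "bounded_clinear A" "bij A"
    using assms Bpos_bb_bij by (auto simp: Bpos_bb_def)
  interpret bounded_linear A
    using A(1) by (simp add: bounded_clinear_def)
  have scale: "A (c *\<^sub>C x) = c *\<^sub>C A x" for c x
    using A(1) by (simp add: bounded_clinear_def)
  have A_inv: "A (inv A x) = x" for x
    using A(2) by (simp add: bij_is_surj surj_f_inv_f)
  have inv_eqI: "inv A x = y" if "A y = x" for x y
    using A(2) that by (metis bij_inv_eq_iff)
  obtain m where m: "0 < m" "\<And>x. m * norm x \<le> norm (A x)"
    using assms by (auto simp: Bpos_bb_def bounded_below_def)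
  obtain K where K: "0 < K" "\<And>x. norm (A x) \<le> K * norm x"
    using bounded_clinear_bound[OF A(1)] by blast
  obtain c where c: "0 < c" "\<And>x. c * (norm x)\<^sup>2 \<le> Re (cinner (A x) x)"
    using Bpos_bb_coercive[OF assms] by blast
  have form: "cinner (inv A x) x = cinner (A (inv A x)) (inv A x)" for x
    by (subst Bpos_bb_selfadjoint[OF assms]) (simp add: A_inv)
  show ?thesis
  proof (rule Bpos_bb_I)
    show "bounded_clinear (inv A)"
    proof (rule bounded_clinearI)
      show "inv A (x + y) = inv A x + inv A y" for x y
        by (rule inv_eqI) (simp add: add A_inv)
      show "inv A (a *\<^sub>C x) = a *\<^sub>C inv A x" for a x
        by (rule inv_eqI) (simp add: scale A_inv)
      show "norm (inv A x) \<le> (1 / m) * norm x" for x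
        using m(1) m(2)[of "inv A x"] by (simp add: A_inv field_simps)
    qed
    show "0 < c / K\<^sup>2"
      using c(1) K(1) by simp
    show "cinner (inv A x) x \<in> \<real>" for x
      unfolding form using assms by (simp add: Bpos_bb_def positive_operator_def)
    show "c / K\<^sup>2 * (norm x)\<^sup>2 \<le> Re (cinner (inv A x) x)" for x
    proof -
      have "(norm x)\<^sup>2 \<le> (K * norm (inv A x))\<^sup>2"
        using K(2)[of "inv A x"] by (intro power_mono) (auto simp: A_inv)
      then have "c / K\<^sup>2 * (norm x)\<^sup>2 \<le> c / K\<^sup>2 * (K * norm (inv A x))\<^sup>2"
        using c(1) by (intro mult_left_mono) auto
      also have "\<dots> = c * (norm (inv A x))\<^sup>2"
        using K(1) by (simp add: power_mult_distrib)
      also have "\<dots> \<le> Re (cinner (inv A x) x)"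
        unfolding form by (rule c(2))
      finally show ?thesis .
    qed
  qed
qed

subsection \<open>Bessel sequences and their mixed frame operators\<close>

text \<open>The analysis operator of \<open>\<Xi>\<close> followed by the synthesis operator of
  \<open>\<Phi>\<close>. The integral term of (ii) is this operator for \<open>\<Xi>\<close> and
  \<open>\<eta>\<close>, evaluated at \<open>inv T (\<Xi> \<omega>)\<close>.\<close>

definition mixed_operator ::
    "'w measure \<Rightarrow> ('w \<Rightarrow> 'a::complex_inner) \<Rightarrow> ('w \<Rightarrow> 'a) \<Rightarrow> 'a \<Rightarrow> 'a"
  where "mixed_operator M \<Xi> \<Phi> \<xi> = weak_integral M (\<lambda>\<omega>. cinner \<xi> (\<Xi> \<omega>) *\<^sub>C \<Phi> \<omega>)"

lemma frame_operator_eq_mixed: "frame_operator M \<Xi> = mixed_operator M \<Xi> \<Xi>"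
  by (simp add: fun_eq_iff frame_operator_def mixed_operator_def)

section \<open>Measurability, and Bessel bounds for images and sums of families\<close>

lemma weakly_measurableD:
  assumes "weakly_measurable M \<Xi>"
  shows "(\<lambda>\<omega>. cinner \<xi> (\<Xi> \<omega>)) \<in> borel_measurable M"
    and "(\<lambda>\<omega>. cinner (\<Xi> \<omega>) \<xi>) \<in> borel_measurable M"
proof -
  show *: "(\<lambda>\<omega>. cinner \<xi> (\<Xi> \<omega>)) \<in> borel_measurable M"
    using assms by (simp add: weakly_measurable_def)
  have "(\<lambda>\<omega>. cnj (cinner \<xi> (\<Xi> \<omega>))) \<in> borel_measurable M"
    using * by (rule borel_measurable_continuous_on[rotated]) (intro continuous_intros)
  then show "(\<lambda>\<omega>. cinner (\<Xi> \<omega>) \<xi>) \<in> borel_measurable M"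
    by (subst cinner_commute)
qed

text \<open>Needed because (ii) prescribes \<open>\<Phi>\<close> on \<open>space M\<close> only,
  while families are total functions.\<close>

lemma bessel_sequence_cong:
  assumes "\<And>\<omega>. \<omega> \<in> space M \<Longrightarrow> \<Phi> \<omega> = \<Psi> \<omega>"
  shows "bessel_sequence M \<Phi> \<longleftrightarrow> bessel_sequence M \<Psi>"
proof -
  have "weakly_measurable M \<Phi> \<longleftrightarrow> weakly_measurable M \<Psi>"
    unfolding weakly_measurable_def by (intro all_cong1 measurable_cong) (simp add: assms)
  moreover have "(\<integral>\<^sup>+ \<omega>. ennreal ((cmod (cinner \<xi> (\<Phi> \<omega>)))\<^sup>2) \<partial>M)
      = (\<integral>\<^sup>+ \<omega>. ennreal ((cmod (cinner \<xi> (\<Psi> \<omega>)))\<^sup>2) \<partial>M)" for \<xi>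
    by (rule nn_integral_cong) (simp add: assms)
  ultimately show ?thesis
    by (simp add: bessel_sequence_def)
qed

text \<open>Moving \<open>A\<close> onto the test vector as \<open>B\<close> reduces everything to
  the bound for \<open>\<Xi>\<close> at \<open>B \<xi>\<close>. The uses are self-adjoint inverses,
  where \<open>B = A\<close>, a mixed operator, whose adjoint exchanges the two families, and
  negation.\<close>

lemma bessel_sequence_adjoint:
  assumes "bessel_sequence M \<Xi>" and "bounded_clinear B"
    and adjoint: "\<And>x y. cinner x (A y) = cinner (B x) y"
  shows "bessel_sequence M (\<lambda>\<omega>. A (\<Xi> \<omega>))"
proof -
  obtain D where D: "0 < D" "\<And>\<xi>.
      (\<integral>\<^sup>+ \<omega>. ennreal ((cmod (cinner \<xi> (\<Xi> \<omega>)))\<^sup>2) \<partial>M) \<le> ennreal (D * (norm \<xi>)\<^sup>2)"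
    using assms(1) by (auto simp: bessel_sequence_def)
  obtain K where K: "0 < K" "\<And>x. norm (B x) \<le> K * norm x"
    using bounded_clinear_bound[OF assms(2)] by blast
  have "(\<integral>\<^sup>+ \<omega>. ennreal ((cmod (cinner \<xi> (A (\<Xi> \<omega>))))\<^sup>2) \<partial>M)
      \<le> ennreal ((D * K\<^sup>2) * (norm \<xi>)\<^sup>2)" for \<xi>
  proof -
    have "D * (norm (B \<xi>))\<^sup>2 \<le> D * (K * norm \<xi>)\<^sup>2"
      using D(1) K(2) by (intro mult_left_mono power_mono) auto
    then show ?thesis
      unfolding adjoint
      by (intro order_trans[OF D(2)] ennreal_leI) (simp add: power_mult_distrib)
  qed
  moreover have "0 < D * K\<^sup>2"
    using D(1) K(1) by simp
  ultimately show ?thesis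
    using assms(1) unfolding bessel_sequence_def weakly_measurable_def adjoint by blast
qed

lemma bessel_sequence_add:
  assumes "bessel_sequence M \<Phi>" and "bessel_sequence M \<Psi>"
  shows "bessel_sequence M (\<lambda>\<omega>. \<Phi> \<omega> + \<Psi> \<omega>)"
proof -
  have meas: "(\<lambda>\<omega>. cinner \<xi> (\<Phi> \<omega>)) \<in> borel_measurable M"
    "(\<lambda>\<omega>. cinner \<xi> (\<Psi> \<omega>)) \<in> borel_measurable M" for \<xi>
    using assms weakly_measurableD(1) by (auto simp: bessel_sequence_def)
  obtain D where D: "0 < D" "\<And>\<xi>.
      (\<integral>\<^sup>+ \<omega>. ennreal ((cmod (cinner \<xi> (\<Phi> \<omega>)))\<^sup>2) \<partial>M) \<le> ennreal (D * (norm \<xi>)\<^sup>2)"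
    using assms(1) by (auto simp: bessel_sequence_def)
  obtain E where E: "0 < E" "\<And>\<xi>.
      (\<integral>\<^sup>+ \<omega>. ennreal ((cmod (cinner \<xi> (\<Psi> \<omega>)))\<^sup>2) \<partial>M) \<le> ennreal (E * (norm \<xi>)\<^sup>2)"
    using assms(2) by (auto simp: bessel_sequence_def)
  have square: "(cmod (a + b))\<^sup>2 \<le> 2 * (cmod a)\<^sup>2 + 2 * (cmod b)\<^sup>2" for a b
  proof -
    have "(cmod (a + b))\<^sup>2 \<le> (cmod a + cmod b)\<^sup>2"
      by (intro power_mono norm_triangle_ineq) simp
    also have "\<dots> \<le> 2 * (cmod a)\<^sup>2 + 2 * (cmod b)\<^sup>2"
      using sum_squares_bound[of "cmod a" "cmod b"] by (simp add: power2_sum)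
    finally show ?thesis .
  qed
  have "(\<integral>\<^sup>+ \<omega>. ennreal ((cmod (cinner \<xi> (\<Phi> \<omega> + \<Psi> \<omega>)))\<^sup>2) \<partial>M)
      \<le> ennreal ((2 * D + 2 * E) * (norm \<xi>)\<^sup>2)" for \<xi>
  proof -
    have "(\<integral>\<^sup>+ \<omega>. ennreal ((cmod (cinner \<xi> (\<Phi> \<omega> + \<Psi> \<omega>)))\<^sup>2) \<partial>M)
        \<le> (\<integral>\<^sup>+ \<omega>. 2 * ennreal ((cmod (cinner \<xi> (\<Phi> \<omega>)))\<^sup>2)
            + 2 * ennreal ((cmod (cinner \<xi> (\<Psi> \<omega>)))\<^sup>2) \<partial>M)"
      unfolding cinner_add_right
      by (intro nn_integral_mono order_trans[OF ennreal_leI[OF square]])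
        (simp add: ennreal_mult)
    also have "\<dots> = 2 * (\<integral>\<^sup>+ \<omega>. ennreal ((cmod (cinner \<xi> (\<Phi> \<omega>)))\<^sup>2) \<partial>M)
        + 2 * (\<integral>\<^sup>+ \<omega>. ennreal ((cmod (cinner \<xi> (\<Psi> \<omega>)))\<^sup>2) \<partial>M)"
      using meas by (simp add: nn_integral_add nn_integral_cmult)
    also have "\<dots> \<le> 2 * ennreal (D * (norm \<xi>)\<^sup>2) + 2 * ennreal (E * (norm \<xi>)\<^sup>2)"
      by (intro add_mono mult_left_mono D E) auto
    also have "\<dots> = ennreal (2 * (D * (norm \<xi>)\<^sup>2)) + ennreal (2 * (E * (norm \<xi>)\<^sup>2))"
      using D(1) E(1) by (simp add: ennreal_mult)
    also have "\<dots> = ennreal ((2 * D + 2 * E) * (norm \<xi>)\<^sup>2)"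
      using D(1) E(1) by (subst ennreal_plus[symmetric]) (auto simp: algebra_simps)
    finally show ?thesis .
  qed
  moreover have "0 < 2 * D + 2 * E"
    using D(1) E(1) by simp
  moreover have "weakly_measurable M (\<lambda>\<omega>. \<Phi> \<omega> + \<Psi> \<omega>)"
    using meas by (simp add: weakly_measurable_def cinner_add_right)
  ultimately show ?thesis
    unfolding bessel_sequence_def by blast
qed

lemma bessel_sequence_diff:
  assumes "bessel_sequence M \<Phi>" and "bessel_sequence M \<Psi>"
  shows "bessel_sequence M (\<lambda>\<omega>. \<Phi> \<omega> - \<Psi> \<omega>)"
proof -
  have "uminus (c *\<^sub>C x) = c *\<^sub>C - (x::'b)" for c x
    by (rule cinner_eqI) (simp add: cinner_minus_left cinner_scaleC_left)
  then have "bounded_clinear (uminus :: 'b \<Rightarrow> 'b)"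
    by (intro bounded_clinearI[where K = 1]) auto
  then have "bessel_sequence M (\<lambda>\<omega>. - \<Psi> \<omega>)"
    by (rule bessel_sequence_adjoint[OF assms(2)]) (simp add: cinner_minus_left cinner_minus_right)
  from bessel_sequence_add[OF assms(1) this] show ?thesis
    by simp
qed

text \<open>Stated for nonnegative integrals, so it can serve to prove integrability as well as to
  give the lower frame bound in (iii).\<close>

lemma mixed_Cauchy_Schwarz:
  assumes "weakly_measurable M \<Xi>" and "weakly_measurable M \<Phi>"
  shows "(\<integral>\<^sup>+ \<omega>. cmod (cinner \<xi> (\<Xi> \<omega>) * cinner (\<Phi> \<omega>) \<zeta>) \<partial>M)\<^sup>2
    \<le> (\<integral>\<^sup>+ \<omega>. ennreal ((cmod (cinner \<xi> (\<Xi> \<omega>)))\<^sup>2) \<partial>M)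
      * (\<integral>\<^sup>+ \<omega>. ennreal ((cmod (cinner \<zeta> (\<Phi> \<omega>)))\<^sup>2) \<partial>M)"
proof -
  have [measurable]: "(\<lambda>\<omega>. cinner \<xi> (\<Xi> \<omega>)) \<in> borel_measurable M"
    "(\<lambda>\<omega>. cinner \<zeta> (\<Phi> \<omega>)) \<in> borel_measurable M"
    using assms weakly_measurableD(1) by blast+
  have "cmod (cinner (\<Phi> \<omega>) \<zeta>) = cmod (cinner \<zeta> (\<Phi> \<omega>))" for \<omega>
    by (metis cinner_commute complex_mod_cnj)
  then show ?thesis
    using Cauchy_Schwarz_nn_integral[of "\<lambda>\<omega>. ennreal (cmod (cinner \<xi> (\<Xi> \<omega>)))" M
        "\<lambda>\<omega>. ennreal (cmod (cinner \<zeta> (\<Phi> \<omega>)))"]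
    by (simp add: norm_mult ennreal_mult ennreal_power)
qed

text \<open>Two Bessel families define a bounded sesquilinear form, with constant the square root of
  the product of their bounds. Uniformity in both vectors matters: one feeds the Riesz theorem, the
  other the boundedness of the resulting operator.\<close>

lemma mixed_integral:
  assumes "bessel_sequence M \<Xi>" and "bessel_sequence M \<Phi>"
  shows "integrable M (\<lambda>\<omega>. cinner \<xi> (\<Xi> \<omega>) * cinner (\<Phi> \<omega>) \<zeta>)"
    and "\<exists>K\<ge>0. \<forall>\<xi> \<zeta>. cmod (LINT \<omega>|M. cinner \<xi> (\<Xi> \<omega>) * cinner (\<Phi> \<omega>) \<zeta>) \<le> K * norm \<xi> * norm \<zeta>"
proof -
  have wm: "weakly_measurable M \<Xi>" "weakly_measurable M \<Phi>"
    using assms by (auto simp: bessel_sequence_def)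
  obtain D where D: "0 < D" "\<And>\<xi>.
      (\<integral>\<^sup>+ \<omega>. ennreal ((cmod (cinner \<xi> (\<Xi> \<omega>)))\<^sup>2) \<partial>M) \<le> ennreal (D * (norm \<xi>)\<^sup>2)"
    using assms(1) by (auto simp: bessel_sequence_def)
  obtain E where E: "0 < E" "\<And>\<xi>.
      (\<integral>\<^sup>+ \<omega>. ennreal ((cmod (cinner \<xi> (\<Phi> \<omega>)))\<^sup>2) \<partial>M) \<le> ennreal (E * (norm \<xi>)\<^sup>2)"
    using assms(2) by (auto simp: bessel_sequence_def)
  define I where "I \<xi> \<zeta> = (\<integral>\<^sup>+ \<omega>. cmod (cinner \<xi> (\<Xi> \<omega>) * cinner (\<Phi> \<omega>) \<zeta>) \<partial>M)" for \<xi> \<zeta>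
  have I: "(I \<xi> \<zeta>)\<^sup>2 \<le> ennreal ((sqrt (D * E) * norm \<xi> * norm \<zeta>)\<^sup>2)" for \<xi> \<zeta>
  proof -
    have "(I \<xi> \<zeta>)\<^sup>2 \<le> ennreal (D * (norm \<xi>)\<^sup>2) * ennreal (E * (norm \<zeta>)\<^sup>2)"
      unfolding I_def by (intro order_trans[OF mixed_Cauchy_Schwarz[OF wm]] mult_mono D E) auto
    then show ?thesis
      using D(1) E(1) by (simp add: ennreal_mult[symmetric] power_mult_distrib mult_ac)
  qed
  have I_finite: "I \<xi> \<zeta> < \<infinity>" for \<xi> \<zeta>
    using le_less_trans[OF I ennreal_less_top] by (simp add: power_less_top_ennreal)
  show int: "integrable M (\<lambda>\<omega>. cinner \<xi> (\<Xi> \<omega>) * cinner (\<Phi> \<omega>) \<zeta>)" for \<xi> \<zeta>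
    using I_finite[of \<xi> \<zeta>] unfolding I_def
    by (intro integrableI_bounded borel_measurable_times weakly_measurableD wm) auto
  have "cmod (LINT \<omega>|M. cinner \<xi> (\<Xi> \<omega>) * cinner (\<Phi> \<omega>) \<zeta>)
      \<le> sqrt (D * E) * norm \<xi> * norm \<zeta>" for \<xi> \<zeta>
  proof -
    have "ennreal ((cmod (LINT \<omega>|M. cinner \<xi> (\<Xi> \<omega>) * cinner (\<Phi> \<omega>) \<zeta>))\<^sup>2) \<le> (I \<xi> \<zeta>)\<^sup>2"
      unfolding I_def ennreal_power[OF norm_ge_zero, symmetric]
      by (intro power_mono integral_norm_bound_ennreal int) auto
    then have "(cmod (LINT \<omega>|M. cinner \<xi> (\<Xi> \<omega>) * cinner (\<Phi> \<omega>) \<zeta>))\<^sup>2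
        \<le> (sqrt (D * E) * norm \<xi> * norm \<zeta>)\<^sup>2"
      by (rule iffD1[OF ennreal_le_iff[OF zero_le_power2] order_trans[OF _ I]])
    then show ?thesis
      by (rule power2_le_imp_le) (use D(1) E(1) in simp)
  qed
  moreover have "0 \<le> sqrt (D * E)"
    using D(1) E(1) by simp
  ultimately show "\<exists>K\<ge>0. \<forall>\<xi> \<zeta>. cmod (LINT \<omega>|M. cinner \<xi> (\<Xi> \<omega>) * cinner (\<Phi> \<omega>) \<zeta>)
      \<le> K * norm \<xi> * norm \<zeta>"
    by (intro exI[of _ "sqrt (D * E)"]) simp
qed

section \<open>Existence of the weak integral and the calculus of mixed operators\<close>

lemma weak_integral_eqI:
  assumes "has_weak_integral M f v"
  shows "weak_integral M f = v"
  unfolding weak_integral_def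
proof (rule the_equality)
  show "has_weak_integral M f v"
    by fact
next
  fix u
  assume "has_weak_integral M f u"
  then show "u = v"
    using assms has_bochner_integral_eq unfolding has_weak_integral_def by (metis cinner_eqI)
qed

text \<open>Here the weak integral is shown to exist: the scalar integral is antilinear and bounded
  in the test vector, so Riesz represents it by a vector. This is the working characterisation of
  \<open>mixed_operator\<close> from here on.\<close>

lemma has_bochner_integral_mixed_operator:
  fixes \<Xi> \<Phi> :: "'w \<Rightarrow> 'a::chilbert_space"
  assumes "bessel_sequence M \<Xi>" and "bessel_sequence M \<Phi>"
  shows "has_bochner_integral M (\<lambda>\<omega>. cinner \<xi> (\<Xi> \<omega>) * cinner (\<Phi> \<omega>) \<zeta>)
    (cinner (mixed_operator M \<Xi> \<Phi> \<xi>) \<zeta>)"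
proof -
  define F where "F \<zeta> = (LINT \<omega>|M. cinner \<xi> (\<Xi> \<omega>) * cinner (\<Phi> \<omega>) \<zeta>)" for \<zeta>
  note int = mixed_integral(1)[OF assms]
  obtain K where K: "\<And>\<zeta>. cmod (F \<zeta>) \<le> K * norm \<xi> * norm \<zeta>"
    using mixed_integral(2)[OF assms] unfolding F_def by blast
  obtain v where v: "\<And>\<zeta>. cinner v \<zeta> = F \<zeta>"
  proof (rule riesz_antilinear[of F])
    show "F (x + y) = F x + F y" for x y
      using int by (simp add: F_def cinner_add_right distrib_left)
    show "F (a *\<^sub>C x) = cnj a * F x" for a x
      by (simp add: F_def cinner_scaleC_right mult.left_commute)
  qed (use K in auto)
  have "has_weak_integral M (\<lambda>\<omega>. cinner \<xi> (\<Xi> \<omega>) *\<^sub>C \<Phi> \<omega>) v"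
    unfolding has_weak_integral_def v F_def cinner_scaleC_left
    by (auto intro: has_bochner_integral_integrable int)
  then have "mixed_operator M \<Xi> \<Phi> \<xi> = v"
    unfolding mixed_operator_def by (rule weak_integral_eqI)
  then show ?thesis
    by (simp add: v F_def has_bochner_integral_integrable int)
qed

lemma mixed_operator_eqI:
  fixes \<Xi> \<Phi> :: "'w \<Rightarrow> 'a::chilbert_space"
  assumes "bessel_sequence M \<Xi>" and "bessel_sequence M \<Phi>"
    and "\<And>\<zeta>. has_bochner_integral M (\<lambda>\<omega>. cinner \<xi> (\<Xi> \<omega>) * cinner (\<Phi> \<omega>) \<zeta>) (cinner v \<zeta>)"
  shows "mixed_operator M \<Xi> \<Phi> \<xi> = v"
  by (rule cinner_eqI)
    (rule has_bochner_integral_eq[OF has_bochner_integral_mixed_operator[OF assms(1,2)] assms(3)])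

lemma mixed_operator_cong:
  assumes "\<And>\<omega>. \<omega> \<in> space M \<Longrightarrow> \<Phi> \<omega> = \<Psi> \<omega>"
  shows "mixed_operator M \<Xi> \<Phi> = mixed_operator M \<Xi> \<Psi>"
proof -
  have "has_bochner_integral M (\<lambda>\<omega>. cinner (cinner \<xi> (\<Xi> \<omega>) *\<^sub>C \<Phi> \<omega>) \<zeta>) w \<longleftrightarrow>
      has_bochner_integral M (\<lambda>\<omega>. cinner (cinner \<xi> (\<Xi> \<omega>) *\<^sub>C \<Psi> \<omega>) \<zeta>) w" for \<xi> \<zeta> w
    by (rule has_bochner_integral_cong) (simp_all add: assms)
  then show ?thesis
    by (simp add: fun_eq_iff mixed_operator_def weak_integral_def has_weak_integral_def)
qed

text \<open>Conjugating the integrand exchanges the roles of the two families and of the two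
  vectors.\<close>

lemma mixed_operator_adjoint:
  fixes \<Xi> \<Phi> :: "'w \<Rightarrow> 'a::chilbert_space"
  assumes "bessel_sequence M \<Xi>" and "bessel_sequence M \<Phi>"
  shows "cinner (mixed_operator M \<Xi> \<Phi> x) y = cinner x (mixed_operator M \<Phi> \<Xi> y)"
proof -
  have "has_bochner_integral M (\<lambda>\<omega>. cnj (cinner y (\<Phi> \<omega>) * cinner (\<Xi> \<omega>) x))
      (cnj (cinner (mixed_operator M \<Phi> \<Xi> y) x))"
    using has_bochner_integral_mixed_operator[OF assms(2,1)]
    by (rule has_bochner_integral_bounded_linear[OF bounded_linear_cnj])
  then have "has_bochner_integral M (\<lambda>\<omega>. cinner x (\<Xi> \<omega>) * cinner (\<Phi> \<omega>) y)
      (cinner x (mixed_operator M \<Phi> \<Xi> y))"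
    by (simp add: cinner_commute[symmetric] mult.commute)
  then show ?thesis
    using has_bochner_integral_mixed_operator[OF assms] has_bochner_integral_eq by blast
qed

lemma bounded_clinear_mixed_operator:
  fixes \<Xi> \<Phi> :: "'w \<Rightarrow> 'a::chilbert_space"
  assumes "bessel_sequence M \<Xi>" and "bessel_sequence M \<Phi>"
  shows "bounded_clinear (mixed_operator M \<Xi> \<Phi>)"
proof -
  let ?S = "mixed_operator M \<Xi> \<Phi>"
  note adjoint = mixed_operator_adjoint[OF assms]
  obtain K where K: "0 \<le> K" "\<And>\<xi> \<zeta>. cmod (cinner (?S \<xi>) \<zeta>) \<le> K * norm \<xi> * norm \<zeta>"
    using mixed_integral(2)[OF assms]
      has_bochner_integral_integral_eq[OF has_bochner_integral_mixed_operator[OF assms]]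
    by auto
  show ?thesis
  proof (rule bounded_clinearI)
    \<comment> \<open>After passing to the adjoint, linearity of the operator is linearity of
      \<open>cinner\<close> in its first slot.\<close>
    show "?S (x + y) = ?S x + ?S y" for x y
      by (rule cinner_eqI) (simp add: adjoint cinner_add_left)
    show "?S (c *\<^sub>C x) = c *\<^sub>C ?S x" for c x
      by (rule cinner_eqI) (simp add: adjoint cinner_scaleC_left)
    show "norm (?S x) \<le> K * norm x" for x
    proof (cases "?S x = 0")
      case False
      \<comment> \<open>The bound for the form, tested on \<open>?S x\<close> itself; one factor is
        then cancelled.\<close>
      have "norm (?S x) * norm (?S x) \<le> K * norm x * norm (?S x)"
        using K(2)[of x "?S x"] complex_Re_le_cmod[of "cinner (?S x) (?S x)"]
        by (simp add: Re_cinner_self power2_eq_square)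
      then show ?thesis
        using False by simp
    qed (simp add: K(1))
  qed
qed

text \<open>A weak integral commutes with \<open>A\<close> because, under \<open>cinner\<close>, the
  adjoint \<open>B\<close> acts on the test vector, outside the integral.\<close>

lemma mixed_operator_compose:
  fixes \<Xi> \<Phi> :: "'w \<Rightarrow> 'a::chilbert_space"
  assumes "bessel_sequence M \<Xi>" and "bessel_sequence M \<Phi>" and "bounded_clinear B"
    and adjoint: "\<And>x y. cinner x (A y) = cinner (B x) y"
  shows "mixed_operator M \<Xi> (\<lambda>\<omega>. A (\<Phi> \<omega>)) \<xi> = A (mixed_operator M \<Xi> \<Phi> \<xi>)"
proof (rule mixed_operator_eqI[OF assms(1) bessel_sequence_adjoint[OF assms(2,3) adjoint]])
  have "cinner (A x) y = cinner x (B y)" for x y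
    by (metis adjoint cinner_commute)
  then show "has_bochner_integral M (\<lambda>\<omega>. cinner \<xi> (\<Xi> \<omega>) * cinner (A (\<Phi> \<omega>)) \<zeta>)
      (cinner (A (mixed_operator M \<Xi> \<Phi> \<xi>)) \<zeta>)" for \<zeta>
    using has_bochner_integral_mixed_operator[OF assms(1,2)] by simp
qed

lemma mixed_operator_add:
  fixes \<Xi> \<Phi> \<Psi> :: "'w \<Rightarrow> 'a::chilbert_space"
  assumes "bessel_sequence M \<Xi>" and "bessel_sequence M \<Phi>" and "bessel_sequence M \<Psi>"
  shows "mixed_operator M \<Xi> (\<lambda>\<omega>. \<Phi> \<omega> + \<Psi> \<omega>) \<xi>
    = mixed_operator M \<Xi> \<Phi> \<xi> + mixed_operator M \<Xi> \<Psi> \<xi>"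
proof (rule mixed_operator_eqI[OF assms(1) bessel_sequence_add[OF assms(2,3)]])
  show "has_bochner_integral M (\<lambda>\<omega>. cinner \<xi> (\<Xi> \<omega>) * cinner (\<Phi> \<omega> + \<Psi> \<omega>) \<zeta>)
      (cinner (mixed_operator M \<Xi> \<Phi> \<xi> + mixed_operator M \<Xi> \<Psi> \<xi>) \<zeta>)" for \<zeta>
    unfolding cinner_add_left distrib_left
    by (rule has_bochner_integral_add; rule has_bochner_integral_mixed_operator; fact)
qed

lemma mixed_operator_diff:
  fixes \<Xi> \<Phi> \<Psi> :: "'w \<Rightarrow> 'a::chilbert_space"
  assumes "bessel_sequence M \<Xi>" and "bessel_sequence M \<Phi>" and "bessel_sequence M \<Psi>"
  shows "mixed_operator M \<Xi> (\<lambda>\<omega>. \<Phi> \<omega> - \<Psi> \<omega>) \<xi>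
    = mixed_operator M \<Xi> \<Phi> \<xi> - mixed_operator M \<Xi> \<Psi> \<xi>"
proof (rule mixed_operator_eqI[OF assms(1) bessel_sequence_diff[OF assms(2,3)]])
  show "has_bochner_integral M (\<lambda>\<omega>. cinner \<xi> (\<Xi> \<omega>) * cinner (\<Phi> \<omega> - \<Psi> \<omega>) \<zeta>)
      (cinner (mixed_operator M \<Xi> \<Phi> \<xi> - mixed_operator M \<Xi> \<Psi> \<xi>) \<zeta>)" for \<zeta>
    unfolding cinner_diff_left right_diff_distrib
    by (rule has_bochner_integral_diff; rule has_bochner_integral_mixed_operator; fact)
qed

subsection \<open>Biframes\<close>

lemma continuous_frame_imp_bessel: "continuous_frame M \<Xi> \<Longrightarrow> bessel_sequence M \<Xi>"
  unfolding continuous_frame_def bessel_sequence_def by blast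

lemma continuous_biframe_lower_bound:
  assumes "continuous_biframe M \<Xi> \<Phi>"
  obtains C where "0 < C" and "\<And>\<xi>. \<exists>r::real.
      has_bochner_integral M (\<lambda>\<omega>. cinner \<xi> (\<Xi> \<omega>) * cinner (\<Phi> \<omega>) \<xi>) (complex_of_real r) \<and>
      C * (norm \<xi>)\<^sup>2 \<le> r"
proof -
  obtain C D where C: "0 < C" and r: "\<forall>\<xi>. \<exists>r::real.
      has_bochner_integral M (\<lambda>\<omega>. cinner \<xi> (\<Xi> \<omega>) * cinner (\<Phi> \<omega>) \<xi>) (complex_of_real r) \<and>
      C * (norm \<xi>)\<^sup>2 \<le> r \<and> r \<le> D * (norm \<xi>)\<^sup>2"
    using assms unfolding continuous_biframe_def by (elim conjE exE)
  show ?thesis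
  proof (rule that[OF C])
    fix \<xi>
    show "\<exists>r::real.
      has_bochner_integral M (\<lambda>\<omega>. cinner \<xi> (\<Xi> \<omega>) * cinner (\<Phi> \<omega>) \<xi>) (complex_of_real r) \<and>
      C * (norm \<xi>)\<^sup>2 \<le> r"
      using spec[OF r, of \<xi>] by (elim exE conjE) (intro exI conjI)
  qed
qed

text \<open>The integral in the biframe condition is the quadratic form of the mixed operator, so
  the lower inequality is coercivity. In the converse direction the upper constant is a norm bound
  of that operator.\<close>

lemma continuous_biframe_iff_Bpos_bb:
  fixes \<Xi> \<Phi> :: "'w \<Rightarrow> 'a::chilbert_space"
  assumes "bessel_sequence M \<Xi>" and "bessel_sequence M \<Phi>"
  shows "continuous_biframe M \<Xi> \<Phi> \<longleftrightarrow> mixed_operator M \<Xi> \<Phi> \<in> Bpos_bb"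
proof
  let ?S = "mixed_operator M \<Xi> \<Phi>"
  note S = has_bochner_integral_mixed_operator[OF assms]
  show "?S \<in> Bpos_bb" if biframe: "continuous_biframe M \<Xi> \<Phi>"
  proof -
    obtain C where C: "0 < C" "\<And>\<xi>. \<exists>r::real.
        has_bochner_integral M (\<lambda>\<omega>. cinner \<xi> (\<Xi> \<omega>) * cinner (\<Phi> \<omega>) \<xi>) (complex_of_real r) \<and>
        C * (norm \<xi>)\<^sup>2 \<le> r"
      using continuous_biframe_lower_bound[OF biframe] by blast
    have "cinner (?S \<xi>) \<xi> \<in> \<real> \<and> C * (norm \<xi>)\<^sup>2 \<le> Re (cinner (?S \<xi>) \<xi>)" for \<xi>
    proof -
      obtain r where "cinner (?S \<xi>) \<xi> = complex_of_real r" "C * (norm \<xi>)\<^sup>2 \<le> r"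
        using C(2)[of \<xi>] has_bochner_integral_eq[OF S] by blast
      then show ?thesis
        by simp
    qed
    then show ?thesis
      by (intro Bpos_bb_I[OF bounded_clinear_mixed_operator[OF assms] C(1)]) auto
  qed
  show "continuous_biframe M \<Xi> \<Phi>" if pos: "?S \<in> Bpos_bb"
  proof -
    obtain C where C: "0 < C" "\<And>x. C * (norm x)\<^sup>2 \<le> Re (cinner (?S x) x)"
      using Bpos_bb_coercive[OF pos] by blast
    obtain D where D: "0 < D" "\<And>x. norm (?S x) \<le> D * norm x"
      using bounded_clinear_bound[OF bounded_clinear_mixed_operator[OF assms]] by blast
    have upper: "Re (cinner (?S x) x) \<le> D * (norm x)\<^sup>2" for x
      using order_trans[OF Re_cinner_le mult_right_mono[OF D(2) norm_ge_zero]]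
      by (simp add: power2_eq_square mult.assoc)
    have "complex_of_real (Re (cinner (?S x) x)) = cinner (?S x) x" for x
      using pos by (simp add: Bpos_bb_def positive_operator_def)
    then have "has_bochner_integral M (\<lambda>\<omega>. cinner x (\<Xi> \<omega>) * cinner (\<Phi> \<omega>) x)
        (complex_of_real (Re (cinner (?S x) x)))" for x
      using S by simp
    then show ?thesis
      using assms C D(1) upper unfolding continuous_biframe_def bessel_sequence_def by blast
  qed
qed

text \<open>For equal families the integrand is a squared modulus, so the form of the operator is
  the nonnegative integral of the frame condition and the lower frame bound is coercivity.\<close>

lemma frame_operator_in_Bpos_bb:
  fixes \<Xi> :: "'w \<Rightarrow> 'a::chilbert_space"
  assumes "continuous_frame M \<Xi>"
  shows "frame_operator M \<Xi> \<in> Bpos_bb"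
proof -
  note bessel = continuous_frame_imp_bessel[OF assms]
  let ?T = "mixed_operator M \<Xi> \<Xi>"
  obtain C where C: "0 < C" "\<And>\<xi>. ennreal (C * (norm \<xi>)\<^sup>2)
      \<le> (\<integral>\<^sup>+ \<omega>. ennreal ((cmod (cinner \<xi> (\<Xi> \<omega>)))\<^sup>2) \<partial>M)"
    using assms unfolding continuous_frame_def by blast
  have T: "has_bochner_integral M (\<lambda>\<omega>. (cmod (cinner \<xi> (\<Xi> \<omega>)))\<^sup>2) (Re (cinner (?T \<xi>) \<xi>))"
    "Im (cinner (?T \<xi>) \<xi>) = 0" for \<xi>
  proof -
    have "cinner \<xi> (\<Xi> \<omega>) * cinner (\<Xi> \<omega>) \<xi> = complex_of_real ((cmod (cinner \<xi> (\<Xi> \<omega>)))\<^sup>2)" for \<omega>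
      by (subst (2) cinner_commute) (simp only: complex_norm_square)
    then have int: "has_bochner_integral M (\<lambda>\<omega>. complex_of_real ((cmod (cinner \<xi> (\<Xi> \<omega>)))\<^sup>2))
        (cinner (?T \<xi>) \<xi>)"
      using has_bochner_integral_mixed_operator[OF bessel bessel, of \<xi> \<xi>] by simp
    show "has_bochner_integral M (\<lambda>\<omega>. (cmod (cinner \<xi> (\<Xi> \<omega>)))\<^sup>2) (Re (cinner (?T \<xi>) \<xi>))"
      using has_bochner_integral_bounded_linear[OF bounded_linear_Re int] by simp
    show "Im (cinner (?T \<xi>) \<xi>) = 0"
      using has_bochner_integral_bounded_linear[OF bounded_linear_Im int]
      by (simp add: has_bochner_integral_iff)
  qed
  have "C * (norm \<xi>)\<^sup>2 \<le> Re (cinner (?T \<xi>) \<xi>)" for \<xi>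
  proof -
    \<comment> \<open>As \<open>ennreal\<close> truncates negative reals to 0, the inequality can be
      taken back to the reals only with a nonnegative right-hand side.\<close>
    have "0 \<le> Re (cinner (?T \<xi>) \<xi>)"
      unfolding has_bochner_integral_integral_eq[OF T(1), symmetric] by simp
    moreover have "(\<integral>\<^sup>+ \<omega>. ennreal ((cmod (cinner \<xi> (\<Xi> \<omega>)))\<^sup>2) \<partial>M)
        = ennreal (Re (cinner (?T \<xi>) \<xi>))"
      using T(1)[of \<xi>] by (simp add: has_bochner_integral_iff nn_integral_eq_integral)
    ultimately show ?thesis
      using C(2)[of \<xi>] by simp
  qed
  then show ?thesis
    unfolding frame_operator_eq_mixed
    by (intro Bpos_bb_I[OF bounded_clinear_mixed_operator[OF bessel bessel] C(1)])
      (auto simp: complex_is_Real_iff T(2))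
qed

text \<open>The square of \<open>C * (norm \<xi>)\<^sup>2\<close> is at most
  \<open>D * (norm \<xi>)\<^sup>2\<close> times the frame integral of \<open>\<Phi>\<close>;
  dividing by \<open>D * (norm \<xi>)\<^sup>2\<close> leaves the constant
  \<open>C\<^sup>2 / D\<close>.\<close>

lemma bessel_biframe_imp_frame:
  fixes \<Xi> \<Phi> :: "'w \<Rightarrow> 'a::chilbert_space"
  assumes "bessel_sequence M \<Xi>" and "bessel_sequence M \<Phi>" and "continuous_biframe M \<Xi> \<Phi>"
  shows "continuous_frame M \<Phi>"
proof -
  have wm: "weakly_measurable M \<Xi>" "weakly_measurable M \<Phi>"
    using assms by (auto simp: bessel_sequence_def)
  obtain D where D: "0 < D" "\<And>\<xi>.
      (\<integral>\<^sup>+ \<omega>. ennreal ((cmod (cinner \<xi> (\<Xi> \<omega>)))\<^sup>2) \<partial>M) \<le> ennreal (D * (norm \<xi>)\<^sup>2)"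
    using assms(1) by (auto simp: bessel_sequence_def)
  obtain E where E: "0 < E" "\<And>\<xi>.
      (\<integral>\<^sup>+ \<omega>. ennreal ((cmod (cinner \<xi> (\<Phi> \<omega>)))\<^sup>2) \<partial>M) \<le> ennreal (E * (norm \<xi>)\<^sup>2)"
    using assms(2) by (auto simp: bessel_sequence_def)
  obtain C where C: "0 < C" "\<And>\<xi>. \<exists>r::real.
      has_bochner_integral M (\<lambda>\<omega>. cinner \<xi> (\<Xi> \<omega>) * cinner (\<Phi> \<omega>) \<xi>) (complex_of_real r) \<and>
      C * (norm \<xi>)\<^sup>2 \<le> r"
    using continuous_biframe_lower_bound[OF assms(3)] by blast
  have "ennreal (C\<^sup>2 / D * (norm \<xi>)\<^sup>2) \<le> (\<integral>\<^sup>+ \<omega>. ennreal ((cmod (cinner \<xi> (\<Phi> \<omega>)))\<^sup>2) \<partial>M)"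
    for \<xi>
  proof (cases "\<xi> = 0")
    case False
    \<comment> \<open>The Bessel bound makes the integral finite, so the cancellation can be done in
      the reals.\<close>
    obtain e where e: "0 \<le> e"
      "(\<integral>\<^sup>+ \<omega>. ennreal ((cmod (cinner \<xi> (\<Phi> \<omega>)))\<^sup>2) \<partial>M) = ennreal e"
      using E(2)[of \<xi>] by (metis enn2real_nonneg ennreal_enn2real ennreal_less_top le_less_trans)
    obtain r where r: "C * (norm \<xi>)\<^sup>2 \<le> r"
      "has_bochner_integral M (\<lambda>\<omega>. cinner \<xi> (\<Xi> \<omega>) * cinner (\<Phi> \<omega>) \<xi>) (complex_of_real r)"
      using C(2) by blast
    have "ennreal (C * (norm \<xi>)\<^sup>2)
        \<le> (\<integral>\<^sup>+ \<omega>. cmod (cinner \<xi> (\<Xi> \<omega>) * cinner (\<Phi> \<omega>) \<xi>) \<partial>M)"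
      using r(1) has_bochner_integral_norm_bound[OF r(2)]
      by (elim order_trans[rotated]) (simp add: ennreal_leI)
    then have "(ennreal (C * (norm \<xi>)\<^sup>2))\<^sup>2
        \<le> (\<integral>\<^sup>+ \<omega>. cmod (cinner \<xi> (\<Xi> \<omega>) * cinner (\<Phi> \<omega>) \<xi>) \<partial>M)\<^sup>2"
      by (rule power_mono) simp
    also have "\<dots> \<le> ennreal (D * (norm \<xi>)\<^sup>2) * ennreal e"
      by (intro order_trans[OF mixed_Cauchy_Schwarz[OF wm]] mult_mono D) (simp_all add: e)
    also have "\<dots> = ennreal (D * (norm \<xi>)\<^sup>2 * e)"
      using D(1) e(1) by (simp add: ennreal_mult)
    finally have "(C * (norm \<xi>)\<^sup>2)\<^sup>2 \<le> D * (norm \<xi>)\<^sup>2 * e"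
      using C(1) D(1) e(1) by (simp add: ennreal_power)
    then have "C\<^sup>2 / D * (norm \<xi>)\<^sup>2 \<le> e"
      using False D(1) by (simp add: field_simps power2_eq_square)
    then show ?thesis
      unfolding e(2) by (rule ennreal_leI)
  qed simp
  moreover have "0 < C\<^sup>2 / D"
    using C(1) D(1) by simp
  ultimately show ?thesis
    unfolding continuous_frame_def using wm(2) E by blast
qed

theorem theorem3p19:
  fixes M :: "'w measure"
    and \<Xi> \<Phi> :: "'w \<Rightarrow> 'a::chilbert_space"
  assumes "separable_space (euclidean :: 'a topology)"
    and "continuous_frame M \<Xi>"
  defines "T \<equiv> frame_operator M \<Xi>"
  defines "cond_i \<equiv> bessel_sequence M \<Phi> \<and> continuous_biframe M \<Xi> \<Phi>"
    and "cond_ii \<equiv> (\<exists>\<eta> Q. bessel_sequence M \<eta> \<and> Q \<in> Bpos_bb \<and>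
           (\<forall>\<omega>\<in>space M. \<Phi> \<omega> = inv (T \<circ> Q) (\<Xi> \<omega>) + \<eta> \<omega>
              - weak_integral M (\<lambda>k. cinner (inv T (\<Xi> \<omega>)) (\<Xi> k) *\<^sub>C \<eta> k)))"
    and "cond_iii \<equiv> continuous_frame M \<Phi> \<and> continuous_biframe M \<Xi> \<Phi>"
  shows "(cond_i \<longleftrightarrow> cond_ii) \<and> (cond_ii \<longleftrightarrow> cond_iii)"
proof -
  note \<Xi> = continuous_frame_imp_bessel[OF assms(2)]
  have T: "T \<in> Bpos_bb"
    unfolding T_def by (rule frame_operator_in_Bpos_bb[OF assms(2)])
  note T_bij = Bpos_bb_bij[OF T]
  have inv_clinear: "bounded_clinear (inv A)" if "A \<in> Bpos_bb" for A :: "'a \<Rightarrow> 'a"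
    using Bpos_bb_inv[OF that] by (simp add: Bpos_bb_def)
  have inv_selfadjoint: "cinner x (inv A y) = cinner (inv A x) y"
    if "A \<in> Bpos_bb" for A :: "'a \<Rightarrow> 'a" and x y
    by (simp add: Bpos_bb_selfadjoint Bpos_bb_inv that)
  \<comment> \<open>Bijectivity of both factors is what lets \<open>inv\<close> of the composition
    split, in reversed order.\<close>
  have inv_comp: "inv (T \<circ> A) x = inv A (inv T x)" if "A \<in> Bpos_bb" for A x
    using o_inv_distrib[OF T_bij Bpos_bb_bij[OF that]] by simp
  have "cond_i \<longleftrightarrow> cond_iii"
    unfolding cond_i_def cond_iii_def
    using bessel_biframe_imp_frame[OF \<Xi>] continuous_frame_imp_bessel by blast
  moreover have "cond_i \<longleftrightarrow> cond_ii"
  proof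
    assume cond_i
    then have \<Phi>: "bessel_sequence M \<Phi>" and S: "mixed_operator M \<Xi> \<Phi> \<in> Bpos_bb"
      using continuous_biframe_iff_Bpos_bb[OF \<Xi>] by (auto simp: cond_i_def)
    let ?S = "mixed_operator M \<Xi> \<Phi>"
    have "inv (T \<circ> inv ?S) (\<Xi> \<omega>) = ?S (inv T (\<Xi> \<omega>))" for \<omega>
      by (simp add: inv_comp Bpos_bb_inv S Bpos_bb_bij inv_inv_eq)
    then show cond_ii
      unfolding cond_ii_def using \<Phi> Bpos_bb_inv[OF S]
      by (intro exI[of _ \<Phi>] exI[of _ "inv ?S"]) (simp add: mixed_operator_def)
  next
    assume cond_ii
    then obtain \<eta> Q where \<eta>: "bessel_sequence M \<eta>" and Q: "Q \<in> Bpos_bb"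
      and \<Phi>_eq: "\<And>\<omega>. \<omega> \<in> space M \<Longrightarrow> \<Phi> \<omega> = inv Q (inv T (\<Xi> \<omega>)) + \<eta> \<omega>
          - mixed_operator M \<Xi> \<eta> (inv T (\<Xi> \<omega>))"
      unfolding cond_ii_def by (auto simp: inv_comp mixed_operator_def)
    let ?\<Psi> = "\<lambda>\<omega>. inv Q (inv T (\<Xi> \<omega>)) + \<eta> \<omega> - mixed_operator M \<Xi> \<eta> (inv T (\<Xi> \<omega>))"
    \<comment> \<open>All terms of (ii) other than \<open>\<eta>\<close> are images of
      \<open>\<Xi>\<close>: under \<open>inv T\<close>, then under \<open>inv Q\<close> or under V,
      the mixed operator of \<open>\<Xi>\<close> and \<open>\<eta>\<close>. The adjoint of V is the
      mixed operator of \<open>\<eta>\<close> and \<open>\<Xi>\<close>, so each image is again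
      Bessel.\<close>
    note T\<Xi> = bessel_sequence_adjoint[OF \<Xi> inv_clinear[OF T] inv_selfadjoint[OF T]]
    note QT\<Xi> = bessel_sequence_adjoint[OF T\<Xi> inv_clinear[OF Q] inv_selfadjoint[OF Q]]
    note V_clinear = bounded_clinear_mixed_operator[OF \<eta> \<Xi>]
    have V_adjoint: "cinner x (mixed_operator M \<Xi> \<eta> y) = cinner (mixed_operator M \<eta> \<Xi> x) y" for x y
      by (simp add: mixed_operator_adjoint \<eta> \<Xi>)
    note VT\<Xi> = bessel_sequence_adjoint[OF T\<Xi> V_clinear V_adjoint]
    note bessels = \<Xi> \<eta> QT\<Xi> VT\<Xi> bessel_sequence_add[OF QT\<Xi> \<eta>]
    have \<Phi>: "bessel_sequence M \<Phi>"
      using bessel_sequence_diff[OF bessel_sequence_add[OF QT\<Xi> \<eta>] VT\<Xi>]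
        bessel_sequence_cong[of M \<Phi> ?\<Psi>, OF \<Phi>_eq] by simp
    have "mixed_operator M \<Xi> \<Phi> \<xi> = inv Q \<xi>" for \<xi>
    proof -
      \<comment> \<open>The reconstruction formula for the canonical dual frame.\<close>
      have "mixed_operator M \<Xi> (\<lambda>\<omega>. inv T (\<Xi> \<omega>)) \<xi> = \<xi>"
        using mixed_operator_compose[OF \<Xi> \<Xi> inv_clinear[OF T] inv_selfadjoint[OF T]] T_bij
        by (simp add: T_def frame_operator_eq_mixed bij_is_inj)
      moreover have "mixed_operator M \<Xi> \<Phi> = mixed_operator M \<Xi> ?\<Psi>"
        by (rule mixed_operator_cong) (rule \<Phi>_eq)
      ultimately show ?thesis
        by (simp add: mixed_operator_diff mixed_operator_add bessels
            mixed_operator_compose[OF \<Xi> T\<Xi> inv_clinear[OF Q] inv_selfadjoint[OF Q]]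
            mixed_operator_compose[OF \<Xi> T\<Xi> V_clinear V_adjoint])
    qed
    then have "mixed_operator M \<Xi> \<Phi> = inv Q"
      by (simp add: fun_eq_iff)
    then show cond_i
      using \<Phi> continuous_biframe_iff_Bpos_bb[OF \<Xi> \<Phi>] Bpos_bb_inv[OF Q] by (simp add: cond_i_def)
  qed
  ultimately show ?thesis
    by blast
qed

end
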